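(* Let $C^{ijkl}$ be an elasticity tensor in three dimensions, $\rho>0$ the mass density, and $n$ a unit vector that is an allowed direction for the propagation of a longitudinal (compression) wave, i.e. the wave equation $(v^2g^{il}-\Gamma^{il})U_l=0$ has a solution with $v=v_{\rm L}>0$ and $U_l=\alpha n_l$, $\alpha\neq0$. Then the velocity $v_{\rm L}$ of this wave is determined only by the Cauchy part $S^{ijkl}=C^{(ijkl)}$ of the elasticity tensor: $$v_{\rm L}=\sqrt{S},\qquad S:=\Gamma^{ij}n_in_j=\tfrac1\rho\,S^{ijkl}n_in_jn_kn_l .$$
   Context: Indices run over $1,2,3$; summation over repeated indices; Cartesian coordinates, $g^{ij}=\mathrm{diag}(1,1,1)$. An elasticity tensor is a real fourth-rank tensor $C^{ijkl}$ on $\mathbb R^3$ with $C^{ijkl}=C^{jikl}$, $C^{ijkl}=C^{ijlk}$ (minor symmetries) and $C^{ijkl}=C^{klij}$ (major symmetry). $C^{(ijkl)}$ is $\frac1{4!}$ times the sum over all permutations of the indices. The Christoffel tensor in direction $n$ is $\Gamma^{il}:=\frac1\rho C^{ijkl}n_jn_k$; $v$ is the phase velocity and $U$ the polarization of a plane wave. *)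

theory Defs
  imports "HOL-Analysis.Analysis" "HOL-Combinatorics.Permutations"
begin

text \<open>
  Fourth-rank tensors on \<open>\<real>\<^sup>3\<close> are given by their components in Cartesian coordinates. The metric is
  then the identity matrix, so upper and lower indices are not distinguished.
\<close>

type_synonym tensor4 = "3 \<Rightarrow> 3 \<Rightarrow> 3 \<Rightarrow> 3 \<Rightarrow> real"

definition elasticity_tensor :: "tensor4 \<Rightarrow> bool" where
  "elasticity_tensor C \<longleftrightarrow>
     (\<forall>i j k l. C i j k l = C j i k l) \<and>
     (\<forall>i j k l. C i j k l = C i j l k) \<and>
     (\<forall>i j k l. C i j k l = C k l i j)"

text \<open>
  The totally symmetric part \<open>C\<^sup>(\<^sup>i\<^sup>j\<^sup>k\<^sup>l\<^sup>)\<close>. The permutations act on the positions of the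
  four indices, so all 24 terms are counted even when some of the indices coincide.
\<close>

definition cauchy_part :: "tensor4 \<Rightarrow> tensor4" where
  "cauchy_part C i j k l =
     (1 / fact 4) * (\<Sum>p | p permutes {..<4::nat}.
        C ([i, j, k, l] ! p 0) ([i, j, k, l] ! p 1) ([i, j, k, l] ! p 2) ([i, j, k, l] ! p 3))"

definition christoffel :: "tensor4 \<Rightarrow> real \<Rightarrow> real^3 \<Rightarrow> real^3^3" where
  "christoffel C \<rho> n = (\<chi> i l. (1 / \<rho>) * (\<Sum>j\<in>UNIV. \<Sum>k\<in>UNIV. C i j k l * n $ j * n $ k))"

definition wave_equation :: "tensor4 \<Rightarrow> real \<Rightarrow> real^3 \<Rightarrow> real \<Rightarrow> real^3 \<Rightarrow> bool" where
  "wave_equation C \<rho> n v U \<longleftrightarrow> (v\<^sup>2 *\<^sub>R mat 1 - christoffel C \<rho> n) *v U = 0"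

definition longitudinal_wave :: "tensor4 \<Rightarrow> real \<Rightarrow> real^3 \<Rightarrow> real \<Rightarrow> bool" where
  "longitudinal_wave C \<rho> n v \<longleftrightarrow> v > 0 \<and> (\<exists>\<alpha>. \<alpha> \<noteq> 0 \<and> wave_equation C \<rho> n v (\<alpha> *\<^sub>R n))"

definition christoffel_scalar :: "tensor4 \<Rightarrow> real \<Rightarrow> real^3 \<Rightarrow> real" where
  "christoffel_scalar C \<rho> n = (\<Sum>i\<in>UNIV. \<Sum>j\<in>UNIV. christoffel C \<rho> n $ i $ j * n $ i * n $ j)"

end

theory Submission
  imports Defs
begin

text \<open>
  The index permutations leave the fully contracted \<open>C\<^sup>i\<^sup>j\<^sup>k\<^sup>l n\<^sub>i n\<^sub>j n\<^sub>k n\<^sub>l\<close> unchanged, so only the totally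
  symmetric part of \<open>C\<close> contributes to \<open>n \<bullet> \<Gamma> n\<close>. For a longitudinal wave, \<open>n\<close> is a unit
  eigenvector of \<open>\<Gamma>\<close> with eigenvalue \<open>v\<^sup>2\<close>, and hence \<open>n \<bullet> \<Gamma> n = v\<^sup>2\<close>.
\<close>

lemma sum_lists_length_Suc:
  fixes F :: "'a::finite list \<Rightarrow> 'b::comm_monoid_add"
  shows "(\<Sum>xs | length xs = Suc m. F xs) = (\<Sum>i\<in>UNIV. \<Sum>xs | length xs = m. F (i # xs))"
proof -
  have "(\<Sum>xs | length xs = Suc m. F xs)
      = (\<Sum>(i, xs)\<in>UNIV \<times> {xs. length xs = m}. F (i # xs))"
    by (rule sum.reindex_bij_witness[where i = "\<lambda>(i, xs). i # xs" and j = "\<lambda>xs. (hd xs, tl xs)"])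
       (auto simp: length_Suc_conv)
  then show ?thesis
    by (simp add: sum.cartesian_product)
qed

text \<open>Index quadruples are treated as lists so that a permutation of index positions acts
  through \<open>permute_list\<close>; permuting four nested sums then becomes a single
  reindexing.\<close>

lemma sum_lists_length_4:
  fixes F :: "'a::finite list \<Rightarrow> 'b::comm_monoid_add"
  shows "(\<Sum>xs | length xs = 4. F xs)
    = (\<Sum>i\<in>UNIV. \<Sum>j\<in>UNIV. \<Sum>k\<in>UNIV. \<Sum>l\<in>UNIV. F [i, j, k, l])"
  by (simp add: numeral_eq_Suc sum_lists_length_Suc)

text \<open>\<open>permute_list p\<close> is a bijection of the lists of length \<open>m\<close>
  onto themselves, with inverse \<open>permute_list (inv p)\<close>.\<close>

lemma sum_permute_list:
  fixes F :: "'a list \<Rightarrow> 'b::comm_monoid_add"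
  assumes p: "p permutes {..<m}"
  shows "(\<Sum>xs | length xs = m. F (permute_list p xs)) = (\<Sum>xs | length xs = m. F xs)"
proof (rule sum.reindex_bij_witness[where i = "permute_list (inv p)" and j = "permute_list p"])
  fix xs :: "'a list"
  assume "xs \<in> {xs. length xs = m}"
  then have len: "length xs = m" by simp
  show "permute_list (inv p) (permute_list p xs) = xs"
    using permute_list_compose[of "inv p" xs p] p len
    by (simp add: permutes_inv permutes_inv_o(1))
  show "permute_list p (permute_list (inv p) xs) = xs"
    using permute_list_compose[of p xs "inv p"] p len
    by (simp add: permutes_inv_o(2))
qed auto

definition contraction :: "tensor4 \<Rightarrow> real^3 \<Rightarrow> real" where
  "contraction C n = (\<Sum>i\<in>UNIV. \<Sum>j\<in>UNIV. \<Sum>k\<in>UNIV. \<Sum>l\<in>UNIV.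
     C i j k l * n $ i * n $ j * n $ k * n $ l)"

lemma contraction_eq_sum_lists:
  "contraction C n = (\<Sum>xs | length xs = 4.
     C (xs ! 0) (xs ! 1) (xs ! 2) (xs ! 3) * prod_list (map (($) n) xs))"
  by (simp add: sum_lists_length_4 contraction_def mult.assoc)

text \<open>The product of the components of \<open>n\<close> depends only on the multiset of
  indices. Hence permuting the arguments of \<open>C\<close> alone gives the same summand as
  permuting the whole list.\<close>

lemma contraction_permute:
  assumes p: "p permutes {..<4}"
  shows "(\<Sum>xs | length xs = 4.
      C (xs ! p 0) (xs ! p 1) (xs ! p 2) (xs ! p 3) * prod_list (map (($) n) xs))
    = contraction C n"
proof -
  let ?F = "\<lambda>xs. C (xs ! 0) (xs ! 1) (xs ! 2) (xs ! 3) * prod_list (map (($) n) xs)"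
  have "C (xs ! p 0) (xs ! p 1) (xs ! p 2) (xs ! p 3) * prod_list (map (($) n) xs)
      = ?F (permute_list p xs)" if "length xs = 4" for xs
  proof -
    have "prod_list (map (($) n) (permute_list p xs)) = prod_list (map (($) n) xs)"
      using p that by (metis mset_map mset_permute_list prod_mset_prod_list)
    then show ?thesis
      using p that by (simp add: permute_list_nth)
  qed
  then show ?thesis
    using sum_permute_list[OF p, of ?F] by (simp add: contraction_eq_sum_lists)
qed

lemma contraction_cauchy_part: "contraction (cauchy_part C) n = contraction C n"
proof -
  let ?P = "{p. p permutes {..<4::nat}}"
  let ?w = "\<lambda>xs. prod_list (map (($) n) xs)"
  have entry: "cauchy_part C (xs ! 0) (xs ! 1) (xs ! 2) (xs ! 3)
      = (1 / fact 4) * (\<Sum>p\<in>?P. C (xs ! p 0) (xs ! p 1) (xs ! p 2) (xs ! p 3))"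
    if "length xs = 4" for xs
  proof -
    \<comment> \<open>With this equation the lookups \<open>[i, j, k, l] ! p 0\<close> etc. in
      \<open>cauchy_part_def\<close> become lookups in \<open>xs\<close> itself.\<close>
    have "xs = [xs ! 0, xs ! 1, xs ! 2, xs ! 3]"
      using that by (auto simp: numeral_eq_Suc length_Suc_conv)
    then show ?thesis
      unfolding cauchy_part_def by metis
  qed
  have "contraction (cauchy_part C) n = (\<Sum>xs | length xs = 4. \<Sum>p\<in>?P.
      (1 / fact 4) * (C (xs ! p 0) (xs ! p 1) (xs ! p 2) (xs ! p 3) * ?w xs))"
    unfolding contraction_eq_sum_lists
    by (intro sum.cong refl) (simp only: mem_Collect_eq entry sum_distrib_left sum_distrib_right mult.assoc)
  also have "\<dots> = (1 / fact 4) * (\<Sum>p\<in>?P. \<Sum>xs | length xs = 4.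
      C (xs ! p 0) (xs ! p 1) (xs ! p 2) (xs ! p 3) * ?w xs)"
    by (subst sum.swap) (simp only: sum_distrib_left)
  also have "\<dots> = (1 / fact 4) * (\<Sum>p\<in>?P. contraction C n)"
    by (intro arg_cong2[where f = "(*)"] sum.cong refl contraction_permute) simp
  \<comment> \<open>This count serves the next equation, where the 24 equal terms cancel the factor
    \<open>1 / fact 4\<close>.\<close>
  also have "card ?P = fact 4"
    by (rule card_permutations) simp_all
  then have "(1 / fact 4) * (\<Sum>p\<in>?P. contraction C n) = contraction C n"
    by simp
  finally show ?thesis .
qed

lemma christoffel_scalar_eq_contraction:
  "christoffel_scalar C \<rho> n = (1 / \<rho>) * contraction C n"
proof -
  have "christoffel_scalar C \<rho> n = (\<Sum>i\<in>UNIV. \<Sum>l\<in>UNIV. \<Sum>j\<in>UNIV. \<Sum>k\<in>UNIV.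
      (1 / \<rho>) * (C i j k l * n $ i * n $ j * n $ k * n $ l))"
    unfolding christoffel_scalar_def christoffel_def
    by (simp add: sum_distrib_left sum_distrib_right mult_ac)
  \<comment> \<open>The Christoffel matrix contracts the middle indices \<open>j\<close>,
    \<open>k\<close> of \<open>C\<close> and keeps \<open>i\<close>, \<open>l\<close>. Two swaps
    carry the sum over \<open>l\<close> past \<open>j\<close> and then past
    \<open>k\<close>.\<close>
  also have "\<dots> = (\<Sum>i\<in>UNIV. \<Sum>j\<in>UNIV. \<Sum>l\<in>UNIV. \<Sum>k\<in>UNIV.
      (1 / \<rho>) * (C i j k l * n $ i * n $ j * n $ k * n $ l))"
    by (intro sum.cong refl sum.swap)
  also have "\<dots> = (\<Sum>i\<in>UNIV. \<Sum>j\<in>UNIV. \<Sum>k\<in>UNIV. \<Sum>l\<in>UNIV.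
      (1 / \<rho>) * (C i j k l * n $ i * n $ j * n $ k * n $ l))"
    by (intro sum.cong refl sum.swap)
  finally show ?thesis
    by (simp only: contraction_def sum_distrib_left)
qed

lemma christoffel_scalar_eq_inner:
  "christoffel_scalar C \<rho> n = n \<bullet> (christoffel C \<rho> n *v n)"
  by (simp add: christoffel_scalar_def inner_vec_def matrix_vector_mult_def sum_distrib_left mult_ac)

lemma longitudinal_wave_velocity:
  assumes "norm n = 1" and "longitudinal_wave C \<rho> n v"
  shows "v = sqrt (christoffel_scalar C \<rho> n)"
proof -
  let ?\<Gamma> = "christoffel C \<rho> n"
  obtain \<alpha> where "v > 0" "\<alpha> \<noteq> 0" and "(v\<^sup>2 *\<^sub>R mat 1 - ?\<Gamma>) *v (\<alpha> *\<^sub>R n) = 0"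
    using assms(2) by (auto simp: longitudinal_wave_def wave_equation_def)
  \<comment> \<open>The wave equation is linear in the polarization, so the amplitude \<alpha>
    factors out and can be cancelled.\<close>
  then have "\<alpha> *\<^sub>R (v\<^sup>2 *\<^sub>R n - ?\<Gamma> *v n) = 0"
    by (simp add: matrix_vector_mult_diff_rdistrib matrix_vector_mult_scaleR
        scaleR_matrix_vector_assoc[symmetric] scaleR_diff_right)
  with \<open>\<alpha> \<noteq> 0\<close> have "?\<Gamma> *v n = v\<^sup>2 *\<^sub>R n"
    by simp
  then have "christoffel_scalar C \<rho> n = v\<^sup>2"
    using assms(1) by (simp add: christoffel_scalar_eq_inner norm_eq_1)
  \<comment> \<open>Positivity of \<open>v\<close> selects the positive root of
    \<open>v\<^sup>2\<close>.\<close>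
  with \<open>v > 0\<close> show ?thesis
    by simp
qed

theorem proposition15:
  fixes C :: tensor4 and \<rho> v\<^sub>L :: real and n :: "real^3"
  assumes "elasticity_tensor C"
    and "\<rho> > 0"
    and "norm n = 1"
    and "longitudinal_wave C \<rho> n v\<^sub>L"
  shows "v\<^sub>L = sqrt (christoffel_scalar C \<rho> n) \<and>
    christoffel_scalar C \<rho> n =
      (1 / \<rho>) * (\<Sum>i\<in>UNIV. \<Sum>j\<in>UNIV. \<Sum>k\<in>UNIV. \<Sum>l\<in>UNIV.
        cauchy_part C i j k l * n $ i * n $ j * n $ k * n $ l) \<and>
    (\<forall>C' v'. elasticity_tensor C' \<and> cauchy_part C' = cauchy_part C \<and>
       longitudinal_wave C' \<rho> n v' \<longrightarrow> v' = v\<^sub>L)"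
proof (intro conjI allI impI)
  show "v\<^sub>L = sqrt (christoffel_scalar C \<rho> n)"
    using assms(3,4) by (rule longitudinal_wave_velocity)
  show "christoffel_scalar C \<rho> n =
      (1 / \<rho>) * (\<Sum>i\<in>UNIV. \<Sum>j\<in>UNIV. \<Sum>k\<in>UNIV. \<Sum>l\<in>UNIV.
        cauchy_part C i j k l * n $ i * n $ j * n $ k * n $ l)"
    using contraction_cauchy_part[of C n]
    by (simp only: christoffel_scalar_eq_contraction contraction_def)
next
  fix C' v'
  assume *: "elasticity_tensor C' \<and> cauchy_part C' = cauchy_part C \<and> longitudinal_wave C' \<rho> n v'"
  \<comment> \<open>Both scalars equal \<open>1 / \<rho>\<close> times the contraction of the common
    Cauchy part, and each velocity is the square root of its scalar.\<close>
  then have "christoffel_scalar C' \<rho> n = christoffel_scalar C \<rho> n"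
    by (metis christoffel_scalar_eq_contraction contraction_cauchy_part)
  then show "v' = v\<^sub>L"
    using * assms(3,4) by (metis longitudinal_wave_velocity)
qed

end
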